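(* Let $k_\mathcal{G}=n_\mathcal{G}\ge1$ and $k_\mathcal{H}=n_\mathcal{H}-1\ge1$. Then the polynomials $s_g=\big(\sum_{h\in V(\mathcal{H})}x_{gh}\big)-(n_\mathcal{H}-1)$, $g\in V(\mathcal{G})$, form a $1$-sum-of-squares certificate of $f_{\mathrm{viz}}$, i.e. $f_{\mathrm{viz}}\equiv\sum_{g\in V(\mathcal{G})}s_g^2\pmod{I_{\mathrm{viz}}}$; consequently $\gamma(G)\gamma(H)\le\gamma(G\Box H)$ for all graphs $G$ on $n_\mathcal{G}$ vertices with $\gamma(G)=n_\mathcal{G}$ and $H$ on $n_\mathcal{H}$ vertices with $\gamma(H)=n_\mathcal{H}-1$.
   Context: $\mathbb{K}$ is a subfield of $\mathbb{R}$. $V(\mathcal{G})$ is a set of $n_\mathcal{G}$ vertices with fixed subset $D_\mathcal{G}$ of size $k_\mathcal{G}$; $V(\mathcal{H})$ a disjoint set of $n_\mathcal{H}$ vertices with fixed subset $D_\mathcal{H}$ of size $k_\mathcal{H}$. Variables $e_{gg'}=e_{g'g}$ for 2-subsets of $V(\mathcal{G})$, $e_{hh'}$ for 2-subsets of $V(\mathcal{H})$, $x_{gh}$ for $g\in V(\mathcal{G}),h\in V(\mathcal{H})$; $P$ is the polynomial ring over $\mathbb{K}$ in these. $I_{\mathrm{viz}}\subseteq P$ is generated by: $e_{gg'}^2-e_{gg'}$; $\prod_{g'\in D_\mathcal{G}}(1-e_{gg'})$ for $g\in V(\mathcal{G})\setminus D_\mathcal{G}$; $\prod_{g'\in V(\mathcal{G})\setminus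 S}\sum_{g\in S}e_{gg'}$ for $S\subseteq V(\mathcal{G})$, $|S|=k_\mathcal{G}-1$; the same three families for $\mathcal{H}$; $x_{gh}^2-x_{gh}$; and $(1-x_{gh})\prod_{g'\ne g}(1-e_{gg'}x_{g'h})\prod_{h'\ne h}(1-e_{hh'}x_{gh'})$ for all $g,h$. $f_{\mathrm{viz}}=\sum_{g,h}x_{gh}-k_\mathcal{G}k_\mathcal{H}$. $\gamma(\cdot)$ is the domination number, $G\Box H$ the Cartesian product graph. An $\ell$-sum-of-squares certificate of $f$ modulo $I$ is a family of polynomials $s_i$ of degree $\le\ell$ with $f-\sum s_i^2\in I$. *)

theory Defs
  imports
    "HOL-Library.Poly_Mapping"
    "HOL-Algebra.Algebraic_Closure_Type"
    "HOL-Algebra.Subrings"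
    "Graph_Theory.Pair_Digraph"
begin

section \<open>Polynomials over a subfield of the reals\<close>

text \<open>A polynomial maps each monomial (a finitely supported exponent vector) to its coefficient.\<close>

type_synonym 'v rpoly = "('v \<Rightarrow>\<^sub>0 nat) \<Rightarrow>\<^sub>0 real"

definition var :: "'v \<Rightarrow> 'v rpoly" where
  "var v = Poly_Mapping.single (Poly_Mapping.single v 1) 1"

text \<open>
  The polynomial ring over \<open>K\<close> in the variables \<open>W\<close>, as a subring of the type of all real
  polynomials: both the coefficients and the occurring variables are restricted.
\<close>

definition poly_ring_over :: "real set \<Rightarrow> 'v set \<Rightarrow> 'v rpoly ring" where
  "poly_ring_over K W = ring_of_type_algebra
     \<lparr>carrier := {p. range (Poly_Mapping.lookup p) \<subseteq> K \<and>
                     (\<forall>m \<in> Poly_Mapping.keys p. Poly_Mapping.keys m \<subseteq> W)}\<rparr>"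

text \<open>The zero polynomial gets total degree 0.\<close>

definition total_degree :: "'v rpoly \<Rightarrow> nat" where
  "total_degree p = Max (insert 0
     ((\<lambda>m. \<Sum>v \<in> Poly_Mapping.keys m. Poly_Mapping.lookup m v) ` Poly_Mapping.keys p))"

text \<open>
  The family \<open>(s i)\<close>, \<open>i \<in> A\<close>, of polynomials of \<open>R\<close> is an \<open>l\<close>-sum-of-squares certificate
  of \<open>f\<close> modulo \<open>I\<close>.
\<close>

definition sos_certificate ::
    "'v rpoly ring \<Rightarrow> 'v rpoly set \<Rightarrow> nat \<Rightarrow> 'i set \<Rightarrow> ('i \<Rightarrow> 'v rpoly) \<Rightarrow> 'v rpoly \<Rightarrow> bool" where
  "sos_certificate R I l A s f \<longleftrightarrow>
     finite A \<and> (\<forall>i \<in> A. s i \<in> carrier R \<and> total_degree (s i) \<le> l) \<and>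
     f - (\<Sum>i \<in> A. (s i)\<^sup>2) \<in> I"

section \<open>The Vizing ideal and the Vizing polynomial\<close>

text \<open>
  Edge variables are indexed by sets of vertices, so that the two orders of the end points give
  the same variable; only the 2-subsets are variables of the polynomial ring.
  The constructors keep the two vertex sets apart.
\<close>

datatype ('a, 'b) viz_var = EdgeG "'a set" | EdgeH "'b set" | Pt 'a 'b

definition viz_vars :: "'a set \<Rightarrow> 'b set \<Rightarrow> ('a, 'b) viz_var set" where
  "viz_vars VG VH =
     {EdgeG A | A. A \<subseteq> VG \<and> card A = 2} \<union> {EdgeH B | B. B \<subseteq> VH \<and> card B = 2} \<union>
     {Pt g h | g h. g \<in> VG \<and> h \<in> VH}"

definition eG :: "'a \<Rightarrow> 'a \<Rightarrow> ('a, 'b) viz_var rpoly" where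
  "eG g g' = var (EdgeG {g, g'})"

definition eH :: "'b \<Rightarrow> 'b \<Rightarrow> ('a, 'b) viz_var rpoly" where
  "eH h h' = var (EdgeH {h, h'})"

definition xp :: "'a \<Rightarrow> 'b \<Rightarrow> ('a, 'b) viz_var rpoly" where
  "xp g h = var (Pt g h)"

text \<open>
  The generators coming from one factor with vertex set \<open>V\<close>, fixed subset \<open>D\<close> of size \<open>k\<close> and
  edge variables \<open>e\<close>. The condition \<open>Suc (card S) = card D\<close> says that \<open>S\<close> has \<open>k - 1\<close> elements.
\<close>

definition graph_gens :: "('c \<Rightarrow> 'c \<Rightarrow> 'v rpoly) \<Rightarrow> 'c set \<Rightarrow> 'c set \<Rightarrow> 'v rpoly set" where
  "graph_gens e V D =
     {(e u v)\<^sup>2 - e u v | u v. u \<in> V \<and> v \<in> V \<and> u \<noteq> v} \<union>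
     {\<Prod>v \<in> D. 1 - e u v | u. u \<in> V - D} \<union>
     {\<Prod>v \<in> V - S. \<Sum>u \<in> S. e u v | S. S \<subseteq> V \<and> Suc (card S) = card D}"

definition product_gens :: "'a set \<Rightarrow> 'b set \<Rightarrow> ('a, 'b) viz_var rpoly set" where
  "product_gens VG VH =
     {(xp g h)\<^sup>2 - xp g h | g h. g \<in> VG \<and> h \<in> VH} \<union>
     {(1 - xp g h) * (\<Prod>g' \<in> VG - {g}. 1 - eG g g' * xp g' h)
                   * (\<Prod>h' \<in> VH - {h}. 1 - eH h h' * xp g h') | g h. g \<in> VG \<and> h \<in> VH}"

definition viz_ring :: "real set \<Rightarrow> 'a set \<Rightarrow> 'b set \<Rightarrow> ('a, 'b) viz_var rpoly ring" where
  "viz_ring K VG VH = poly_ring_over K (viz_vars VG VH)"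

definition viz_ideal ::
    "real set \<Rightarrow> 'a set \<Rightarrow> 'a set \<Rightarrow> 'b set \<Rightarrow> 'b set \<Rightarrow> ('a, 'b) viz_var rpoly set" where
  "viz_ideal K VG DG VH DH =
     Idl\<^bsub>viz_ring K VG VH\<^esub>
       (graph_gens eG VG DG \<union> graph_gens eH VH DH \<union> product_gens VG VH)"

definition viz_poly :: "'a set \<Rightarrow> 'a set \<Rightarrow> 'b set \<Rightarrow> 'b set \<Rightarrow> ('a, 'b) viz_var rpoly" where
  "viz_poly VG DG VH DH = (\<Sum>g \<in> VG. \<Sum>h \<in> VH. xp g h) - of_nat (card DG * card DH)"

section \<open>Domination number and Cartesian product\<close>

text \<open>Finite simple graphs are the symmetric loop-free digraphs of the locale \<open>pair_graph\<close>.\<close>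

definition dominating_set :: "'c pair_pre_digraph \<Rightarrow> 'c set \<Rightarrow> bool" where
  "dominating_set G D \<longleftrightarrow>
     D \<subseteq> pverts G \<and> (\<forall>v \<in> pverts G - D. \<exists>u \<in> D. (u, v) \<in> parcs G)"

definition domination_number :: "'c pair_pre_digraph \<Rightarrow> nat" where
  "domination_number G = Min (card ` {D. dominating_set G D})"

definition cartesian_product ::
    "'c pair_pre_digraph \<Rightarrow> 'd pair_pre_digraph \<Rightarrow> ('c \<times> 'd) pair_pre_digraph" where
  "cartesian_product G H =
     \<lparr>pverts = pverts G \<times> pverts H,
      parcs = {((g, h), (g', h')) | g h g' h'.
                 (g = g' \<and> g \<in> pverts G \<and> (h, h') \<in> parcs H) \<or>
                 ((g, g') \<in> parcs G \<and> h = h' \<and> h \<in> pverts H)}\<rparr>"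

end

theory Submission
  imports Defs
begin

text \<open>
  Modulo the ideal all variables are idempotent, and over a field of characteristic 0 a sum of
  idempotents vanishes only if every summand does. So for \<open>k\<^sub>G = n\<^sub>G\<close> all edge variables of \<open>G\<close>
  vanish, and for \<open>k\<^sub>H = n\<^sub>H - 1\<close> the product of any two distinct edge variables of \<open>H\<close> vanishes
  while some edge variable at the vertex outside \<open>D\<^sub>H\<close> is 1: \<open>H\<close> is a single edge with isolated
  vertices. Within each copy of \<open>H\<close> this forces \<open>(1 - x\<^bsub>gh\<^esub>) (1 - x\<^bsub>gh'\<^esub>) = 0\<close> for \<open>h \<noteq> h'\<close>, so that
  \<open>1 - s\<^sub>g\<close>, the sum of the \<open>1 - x\<^bsub>gh\<^esub>\<close> over \<open>h\<close>, is idempotent, and hence so is \<open>s\<^sub>g\<close>. Finally,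
  \<open>f\<^bsub>viz\<^esub>\<close> is the sum of the \<open>s\<^sub>g\<close>.
\<close>

section \<open>Idempotents modulo an ideal of a subring\<close>

text \<open>A subring is kept as a set inside a ring type, so that identities are proved with the
  type class operations while membership in \<open>C\<close> is tracked separately. In the
  application \<open>C\<close> is the carrier of the polynomial ring over the subfield.\<close>

locale comm_subring =
  fixes C :: "'r :: comm_ring_1 set"
  assumes one_C: "1 \<in> C"
    and add_C: "a \<in> C \<Longrightarrow> b \<in> C \<Longrightarrow> a + b \<in> C"
    and uminus_C: "a \<in> C \<Longrightarrow> - a \<in> C"
    and mult_C: "a \<in> C \<Longrightarrow> b \<in> C \<Longrightarrow> a * b \<in> C"
begin

lemma zero_C: "0 \<in> C"
  using add_C[OF one_C uminus_C[OF one_C]] by simp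

lemma diff_C: "a \<in> C \<Longrightarrow> b \<in> C \<Longrightarrow> a - b \<in> C"
  using add_C[of a "- b"] uminus_C by simp

lemma of_nat_C: "of_nat n \<in> C"
  by (induction n) (auto intro: zero_C add_C one_C)

lemma sum_C: "(\<And>i. i \<in> F \<Longrightarrow> f i \<in> C) \<Longrightarrow> sum f F \<in> C"
  by (induction F rule: infinite_finite_induct) (auto intro: zero_C add_C)

lemma prod_C: "(\<And>i. i \<in> F \<Longrightarrow> f i \<in> C) \<Longrightarrow> prod f F \<in> C"
  by (induction F rule: infinite_finite_induct) (auto intro: one_C mult_C)

end

text \<open>\<open>cancel_I\<close> is where characteristic 0 enters: positive integers can be
  divided out modulo \<open>I\<close>.\<close>

locale char0_subring_ideal = comm_subring C for C :: "'r :: comm_ring_1 set" +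
  fixes I :: "'r set"
  assumes zero_I: "0 \<in> I"
    and add_I: "a \<in> I \<Longrightarrow> b \<in> I \<Longrightarrow> a + b \<in> I"
    and mult_I: "c \<in> C \<Longrightarrow> a \<in> I \<Longrightarrow> c * a \<in> I"
    and cancel_I: "a \<in> C \<Longrightarrow> of_nat (Suc n) * a \<in> I \<Longrightarrow> a \<in> I"
begin

lemma mult_I2: "a \<in> I \<Longrightarrow> c \<in> C \<Longrightarrow> a * c \<in> I"
  using mult_I[of c a] by (simp add: mult.commute)

lemma uminus_I: "a \<in> I \<Longrightarrow> - a \<in> I"
  using mult_I[OF uminus_C[OF one_C]] by simp

lemma diff_I: "a \<in> I \<Longrightarrow> b \<in> I \<Longrightarrow> a - b \<in> I"
  using add_I[of a "- b"] uminus_I by simp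

lemma sum_I: "(\<And>i. i \<in> F \<Longrightarrow> f i \<in> I) \<Longrightarrow> sum f F \<in> I"
  by (induction F rule: infinite_finite_induct) (auto intro: zero_I add_I)

text \<open>Multiplying out, every term other than \<open>p\<close> itself contains some
  \<open>p * f v\<close>, so the product is congruent to \<open>p\<close>.\<close>

lemma cancel_prod_one_minus:
  assumes "finite F" and "\<And>v. v \<in> F \<Longrightarrow> f v \<in> C" and "\<And>v. v \<in> F \<Longrightarrow> p * f v \<in> I"
    and "p * (\<Prod>v \<in> F. 1 - f v) \<in> I"
  shows "p \<in> I"
proof -
  have "p - p * (\<Prod>v \<in> F. 1 - f v) \<in> I"
    using assms(1-3)
  proof (induction F rule: finite_induct)
    case empty
    then show ?case by (simp add: zero_I)
  next
    case (insert j F)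
    let ?P = "\<Prod>v \<in> F. 1 - f v"
    have "?P \<in> C"
      using insert.prems(1) by (auto intro!: prod_C diff_C one_C)
    then have "p * f j * ?P \<in> I"
      using insert.prems(2) by (auto intro: mult_I2)
    moreover have "p - p * ?P \<in> I"
      using insert by auto
    ultimately have "(p - p * ?P) + p * f j * ?P \<in> I"
      by (rule add_I[rotated])
    then show ?case
      using insert.hyps by (simp add: algebra_simps)
  qed
  from add_I[OF this assms(4)] show ?thesis by simp
qed

definition idem :: "'r \<Rightarrow> bool" where
  "idem a \<longleftrightarrow> a \<in> C \<and> a\<^sup>2 - a \<in> I"

lemma idem_C: "idem a \<Longrightarrow> a \<in> C"
  by (simp add: idem_def)

lemma idem_mult:
  assumes "idem a" and "idem b"
  shows "idem (a * b)"
proof -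
  have "b\<^sup>2 * (a\<^sup>2 - a) + a * (b\<^sup>2 - b) \<in> I"
    using assms by (auto simp: idem_def power2_eq_square intro!: add_I mult_I mult_C)
  also have "b\<^sup>2 * (a\<^sup>2 - a) + a * (b\<^sup>2 - b) = (a * b)\<^sup>2 - a * b"
    by (simp add: algebra_simps power2_eq_square)
  finally show ?thesis
    using assms by (simp add: idem_def mult_C)
qed

lemma idem_compl:
  assumes "idem a"
  shows "idem (1 - a)" and "a * (1 - a) \<in> I"
proof -
  have "(1 - a)\<^sup>2 - (1 - a) = a\<^sup>2 - a"
    by (simp add: algebra_simps power2_eq_square)
  then show "idem (1 - a)"
    using assms unfolding idem_def by (metis one_C diff_C)
  have "- (a\<^sup>2 - a) \<in> I"
    using assms by (simp add: idem_def uminus_I del: minus_diff_eq)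
  then show "a * (1 - a) \<in> I"
    by (simp add: algebra_simps power2_eq_square)
qed

text \<open>Idempotents behave like values 0 or 1, so a positive integer plus idempotents can be
  cancelled. The induction treats \<open>f j\<close> as 1 and as 0 in turn, which needs
  \<open>a\<close> and \<open>n\<close> arbitrary.\<close>

lemma cancel_Suc_plus_sum_idem:
  assumes "finite F" and "\<And>i. i \<in> F \<Longrightarrow> idem (f i)" and "a \<in> C"
    and "a * (of_nat (Suc n) + sum f F) \<in> I"
  shows "a \<in> I"
  using assms
proof (induction F arbitrary: a n rule: finite_induct)
  case empty
  then show ?case using cancel_I[of a n] by (simp add: mult.commute)
next
  case (insert j F)
  let ?s = "of_nat (Suc n) + sum f F"
  have j: "f j \<in> C" "(f j)\<^sup>2 - f j \<in> I"
    using insert.prems(1)[of j] by (auto simp: idem_def)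
  have F: "\<And>i. i \<in> F \<Longrightarrow> idem (f i)"
    using insert.prems(1) by simp
  have s: "sum f F \<in> C"
    using F by (auto intro: sum_C idem_C)
  have I: "a * (f j + ?s) \<in> I"
    using insert.prems(3) insert.hyps by (simp add: add_ac)
  \<comment> \<open>Multiplied by \<open>f j\<close>, the summand \<open>f j\<close> acts as 1 and
    raises \<open>n\<close> by one; the induction hypothesis applies to
    \<open>f j * a\<close>.\<close>
  have "f j * (a * (f j + ?s)) - a * ((f j)\<^sup>2 - f j) \<in> I"
    using j I insert.prems(2) by (auto intro: mult_I diff_I)
  also have "f j * (a * (f j + ?s)) - a * ((f j)\<^sup>2 - f j)
      = (f j * a) * (of_nat (Suc (Suc n)) + sum f F)"
    by (simp add: algebra_simps power2_eq_square)
  finally have fa: "f j * a \<in> I"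
    using insert.IH[OF F] j insert.prems(2) by (blast intro: mult_C)
  \<comment> \<open>Now \<open>f j\<close> acts on \<open>a\<close> as 0, so the induction
    hypothesis applies to \<open>a\<close> with the same \<open>n\<close>.\<close>
  have "a * (f j + ?s) - f j * a \<in> I"
    using I fa by (rule diff_I)
  then have "a * ?s \<in> I"
    by (simp add: algebra_simps)
  then show ?case
    using insert.IH[OF F] insert.prems(2) by blast
qed

text \<open>Modulo \<open>I\<close>, \<open>f j\<close> times the sum is \<open>f j\<close> times 1
  plus the other idempotents, and this second factor cancels.\<close>

lemma idem_sum_in_ideal:
  assumes "finite F" and "\<And>i. i \<in> F \<Longrightarrow> idem (f i)" and "sum f F \<in> I" and "j \<in> F"
  shows "f j \<in> I"
proof -
  have j: "f j \<in> C" "(f j)\<^sup>2 - f j \<in> I"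
    using assms(2)[OF assms(4)] by (auto simp: idem_def)
  have "f j * sum f F - ((f j)\<^sup>2 - f j) \<in> I"
    by (intro diff_I mult_I j assms(3))
  also have "f j * sum f F - ((f j)\<^sup>2 - f j) = f j * (of_nat (Suc 0) + sum f (F - {j}))"
    using assms(1,4) by (simp add: sum.remove[of F j] algebra_simps power2_eq_square)
  finally show ?thesis
    using cancel_Suc_plus_sum_idem[of "F - {j}" f "f j" 0] assms(1,2) j by auto
qed

lemma orthogonal_idem_sum:
  assumes "finite F" and "\<And>i. i \<in> F \<Longrightarrow> idem (f i)"
    and "\<And>i j. i \<in> F \<Longrightarrow> j \<in> F \<Longrightarrow> i \<noteq> j \<Longrightarrow> f i * f j \<in> I"
  shows "(sum f F)\<^sup>2 - sum f F \<in> I"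
proof -
  \<comment> \<open>The \<open>if\<close> moves the diagonal into the double sum, so that each entry
    lies in \<open>I\<close>: by idempotence for \<open>i = j\<close>, by orthogonality
    otherwise.\<close>
  have "(\<Sum>i \<in> F. \<Sum>j \<in> F. f i * f j - (if i = j then f i else 0)) \<in> I"
    using assms(2,3) by (auto intro!: sum_I simp: idem_def power2_eq_square)
  also have "(\<Sum>i \<in> F. \<Sum>j \<in> F. f i * f j - (if i = j then f i else 0)) = (sum f F)\<^sup>2 - sum f F"
    using assms(1) by (simp add: sum_subtractf power2_eq_square sum_product)
  finally show ?thesis .
qed

section \<open>The structure of the two factors\<close>

text \<open>The sets \<open>S\<close> are the complements of single vertices. For
  \<open>S = V - {v}\<close> the generator is the sum of the edge variables at \<open>v\<close>, and
  idempotence kills each summand.\<close>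

lemma edgeless:
  assumes "finite V" and idem: "\<And>u v. u \<in> V \<Longrightarrow> v \<in> V \<Longrightarrow> u \<noteq> v \<Longrightarrow> idem (e u v)"
    and gen: "\<And>S. S \<subseteq> V \<Longrightarrow> Suc (card S) = card V \<Longrightarrow> (\<Prod>v \<in> V - S. \<Sum>u \<in> S. e u v) \<in> I"
    and "u \<in> V" and "v \<in> V" and "u \<noteq> v"
  shows "e u v \<in> I"
proof -
  have "Suc (card (V - {v})) = card V"
    using assms by (metis card_Suc_Diff1)
  from gen[OF _ this] have "(\<Prod>w \<in> V - (V - {v}). \<Sum>u \<in> V - {v}. e u w) \<in> I"
    by auto
  moreover have "V - (V - {v}) = {v}"
    using assms by auto
  ultimately have "(\<Sum>u \<in> V - {v}. e u v) \<in> I"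
    by simp
  then show ?thesis
    using idem_sum_in_ideal[of "V - {v}" "\<lambda>u. e u v" u] assms by auto
qed

text \<open>The sets \<open>S\<close> are the complements of pairs of vertices. The generator is
  then a product of two sums, which expands to a sum of idempotents \<open>e u a * e w b\<close>; so
  each of these lies in \<open>I\<close>.\<close>

lemma distinct_edges_orthogonal:
  assumes "finite V" and sym: "\<And>u v. e u v = e v u"
    and idem: "\<And>u v. u \<in> V \<Longrightarrow> v \<in> V \<Longrightarrow> u \<noteq> v \<Longrightarrow> idem (e u v)"
    and gen: "\<And>S. S \<subseteq> V \<Longrightarrow> Suc (Suc (card S)) = card V \<Longrightarrow>
                (\<Prod>v \<in> V - S. \<Sum>u \<in> S. e u v) \<in> I"
    and V: "a \<in> V" "a' \<in> V" "b \<in> V" "b' \<in> V"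
    and neq: "a \<noteq> a'" "b \<noteq> b'" "{a, a'} \<noteq> {b, b'}"
  shows "e a a' * e b b' \<in> I"
proof -
  have outer: "e u a * e w b \<in> I"
    if "a \<in> V" "b \<in> V" "a \<noteq> b" "u \<in> V - {a, b}" "w \<in> V - {a, b}" for a b u w
  proof -
    let ?S = "V - {a, b}"
    have "Suc (Suc (card ?S)) = card V"
    proof -
      have "card {a, b} = 2" "{a, b} \<subseteq> V"
        using that by auto
      then show ?thesis
        using \<open>finite V\<close> card_mono[of V "{a, b}"] card_Diff_subset[of "{a, b}" V] by simp
    qed
    from gen[OF _ this] have "(\<Prod>v \<in> V - ?S. \<Sum>u \<in> ?S. e u v) \<in> I"
      by auto
    moreover have "V - ?S = {a, b}"
      using that by auto
    ultimately have "(\<Sum>(u, w) \<in> ?S \<times> ?S. e u a * e w b) \<in> I"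
      using that(3) by (simp add: sum_product sum.cartesian_product)
    moreover have "idem (e u a * e w b)" if "u \<in> ?S" "w \<in> ?S" for u w
      using that \<open>a \<in> V\<close> \<open>b \<in> V\<close> by (auto intro!: idem_mult idem)
    ultimately show ?thesis
      using idem_sum_in_ideal[of "?S \<times> ?S" "\<lambda>(u, w). e u a * e w b" "(u, w)"] that \<open>finite V\<close>
      by auto
  qed
  \<comment> \<open>Of two distinct edges each has an end point outside the other; the cases say
    which end points can be the two vertices left out of \<open>S\<close>.\<close>
  consider "a \<noteq> b \<and> a' \<noteq> b \<and> b' \<noteq> a" | "a \<noteq> b' \<and> a' \<noteq> b' \<and> b \<noteq> a"
    | "a' \<noteq> b \<and> a \<noteq> b \<and> b' \<noteq> a'" | "a' \<noteq> b' \<and> a \<noteq> b' \<and> b \<noteq> a'"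
    using neq by (auto simp: doubleton_eq_iff)
  then show ?thesis
    using outer[of a b a' b'] outer[of a b' a' b] outer[of a' b a b'] outer[of a' b' a b] V neq
      sym[of a a'] sym[of b b']
    by cases auto
qed

text \<open>
  Since \<open>d\<close> is dominated, it suffices to kill the products with each \<open>e d v\<close>. After that
  multiplication \<open>{d, v}\<close> is the only edge, so a vertex \<open>h\<close> that is not in the set has its
  partner in this edge in the set.
\<close>

lemma undominated_orthogonal:
  assumes "finite V" and sym: "\<And>u v. e u v = e v u"
    and e_idem: "\<And>u v. u \<in> V \<Longrightarrow> v \<in> V \<Longrightarrow> u \<noteq> v \<Longrightarrow> idem (e u v)"
    and orth: "\<And>a a' b b'. a \<in> V \<Longrightarrow> a' \<in> V \<Longrightarrow> b \<in> V \<Longrightarrow> b' \<in> V \<Longrightarrow> a \<noteq> a' \<Longrightarrow> b \<noteq> b' \<Longrightarrow>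
                 {a, a'} \<noteq> {b, b'} \<Longrightarrow> e a a' * e b b' \<in> I"
    and D: "D \<subseteq> V" "d \<in> V - D" and gen_D: "(\<Prod>v \<in> D. 1 - e d v) \<in> I"
    and x_idem: "\<And>h. h \<in> V \<Longrightarrow> idem (x h)"
    and gen_x: "\<And>h. h \<in> V \<Longrightarrow> (1 - x h) * (\<Prod>k \<in> V - {h}. 1 - e h k * x k) \<in> I"
    and h: "h \<in> V" "h' \<in> V" "h \<noteq> h'"
  shows "(1 - x h) * (1 - x h') \<in> I"
proof (rule cancel_prod_one_minus[where F = D and f = "e d"])
  show "finite D" using assms(1) D(1) by (rule finite_subset[rotated])
  have x: "x h \<in> C" "1 - x h \<in> C" if "h \<in> V" for h
    using x_idem[OF that] by (auto simp: idem_C intro: diff_C one_C)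
  have e: "e u v \<in> C" if "u \<in> V" "v \<in> V" "u \<noteq> v" for u v
    using e_idem[OF that] by (rule idem_C)
  show "(1 - x h) * (1 - x h') * (\<Prod>v \<in> D. 1 - e d v) \<in> I"
    using gen_D x h by (auto intro!: mult_I mult_C)
  fix v assume v: "v \<in> D"
  then have dv: "d \<in> V" "v \<in> V" "d \<noteq> v"
    using D by auto
  then show "e d v \<in> C" by (rule e)
  \<comment> \<open>By \<open>E\<close>, if \<open>h\<close> lies on the edge \<open>{d, v}\<close>,
    then \<open>h'\<close> is its other end. Multiplying the generator at \<open>h\<close> by
    \<open>(1 - x h') * e d v\<close> makes each \<open>e h k * x k\<close> vanish.\<close>
  have key: "(1 - x h) * (1 - x h') * e d v \<in> I"
    if h: "h \<in> V" "h' \<in> V" "h \<noteq> h'" and E: "h \<in> {d, v} \<Longrightarrow> {h, h'} = {d, v}" for h h'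
  proof (rule cancel_prod_one_minus[where F = "V - {h}" and f = "\<lambda>k. e h k * x k"])
    let ?p = "(1 - x h) * (1 - x h') * e d v"
    show "finite (V - {h})" using \<open>finite V\<close> by simp
    have "((1 - x h') * e d v) * ((1 - x h) * (\<Prod>k \<in> V - {h}. 1 - e h k * x k)) \<in> I"
      using gen_x h x dv e by (intro mult_I[OF mult_C]) auto
    then show "?p * (\<Prod>k \<in> V - {h}. 1 - e h k * x k) \<in> I"
      by (simp add: mult_ac)
    fix k assume "k \<in> V - {h}"
    then have k: "k \<in> V" "h \<noteq> k" by auto
    show "e h k * x k \<in> C"
      using h k e x by (auto intro!: mult_C)
    show "?p * (e h k * x k) \<in> I"
    \<comment> \<open>If \<open>k\<close> is the partner of \<open>h\<close> on this edge, then
      \<open>k = h'\<close> and \<open>x h' * (1 - x h')\<close> vanishes; otherwise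
      \<open>e d v * e h k\<close> is a product of distinct edges.\<close>
    proof (cases "{d, v} = {h, k}")
      case True
      with E have "k = h'" by (auto simp: doubleton_eq_iff)
      have "((1 - x h) * e d v * e h k) * (x h' * (1 - x h')) \<in> I"
        using h k dv e x idem_compl(2)[OF x_idem]
        by (intro mult_I[OF mult_C[OF mult_C]]) auto
      then show ?thesis
        using \<open>k = h'\<close> by (simp add: mult_ac)
    next
      case False
      have "((1 - x h) * (1 - x h') * x k) * (e d v * e h k) \<in> I"
        using orth[of d v h k] False h k dv x by (intro mult_I[OF mult_C[OF mult_C]]) auto
      then show ?thesis
        by (simp add: mult_ac)
    qed
  qed
  show "(1 - x h) * (1 - x h') * e d v \<in> I"
  \<comment> \<open>The claim is symmetric in \<open>h\<close> and \<open>h'\<close>: if only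
    \<open>h\<close> is on the edge, swapping them makes \<open>E\<close> vacuous. Otherwise
    \<open>h\<close> is off the edge or both vertices are its ends.\<close>
  proof (cases "h \<in> {d, v} \<and> h' \<notin> {d, v}")
    case True
    then show ?thesis
      using key[of h' h] h by (auto simp: mult_ac)
  next
    case False
    then show ?thesis
      using h by (intro key) auto
  qed
qed

end

section \<open>The ring over a subfield and its ideals\<close>

text \<open>Translates closure under the record operations into closure under the type class
  operations. Negation and inverse are not record fields and are identified by uniqueness.\<close>

lemma subfield_type_algebraD:
  fixes K :: "'k :: field set"
  assumes "subfield K ring_of_type_algebra"
  shows "0 \<in> K" and "1 \<in> K" and "a \<in> K \<Longrightarrow> b \<in> K \<Longrightarrow> a + b \<in> K" and "a \<in> K \<Longrightarrow> - a \<in> K"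
    and "a \<in> K \<Longrightarrow> b \<in> K \<Longrightarrow> a * b \<in> K" and "a \<in> K \<Longrightarrow> inverse a \<in> K"
proof -
  let ?R = "ring_of_type_algebra :: 'k ring"
  interpret field ?R by rule
  have sel: "zero ?R = 0" "one ?R = 1" "add ?R = (+)" "monoid.mult ?R = (*)" "carrier ?R = UNIV"
    by (auto simp: ring_of_type_algebra_def)
  note E = subringE[OF subfieldE(1)[OF assms], unfolded sel]
  show zero: "0 \<in> K" and "1 \<in> K" and "a \<in> K \<Longrightarrow> b \<in> K \<Longrightarrow> a + b \<in> K"
    and "a \<in> K \<Longrightarrow> b \<in> K \<Longrightarrow> a * b \<in> K"
    using E by auto
  have "\<ominus>\<^bsub>?R\<^esub> a = - a"
    by (rule minus_equality) (auto simp: sel)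
  then show "a \<in> K \<Longrightarrow> - a \<in> K"
    using E(5)[of a] by simp
  show "inverse a \<in> K" if "a \<in> K"
  proof (cases "a = 0")
    case False
    then have a: "a \<in> K - {\<zero>\<^bsub>?R\<^esub>}" using that by (simp add: sel)
    have "inv\<^bsub>?R\<^esub> a \<in> K" and "a * inv\<^bsub>?R\<^esub> a = 1"
      using subfield_m_inv(1,2)[OF assms a] by (auto simp: sel)
    then show ?thesis
      by (metis inverse_unique)
  qed (simp add: zero)
qed

lemma mem_carrier_poly_ring_over:
  "p \<in> carrier (poly_ring_over K W) \<longleftrightarrow>
     (\<forall>m. Poly_Mapping.lookup p m \<in> K) \<and>
     (\<forall>m \<in> Poly_Mapping.keys p. Poly_Mapping.keys m \<subseteq> W)"
  by (auto simp: poly_ring_over_def)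

lemma poly_ring_over_simps [simp]:
  "zero (poly_ring_over K W) = 0"
  "add (poly_ring_over K W) = (+)" "monoid.mult (poly_ring_over K W) = (*)"
  by (simp_all add: poly_ring_over_def ring_of_type_algebra_def)

lemma single_in_poly_ring_over:
  assumes "0 \<in> K" and "c \<in> K" and "Poly_Mapping.keys m \<subseteq> W"
  shows "Poly_Mapping.single m c \<in> carrier (poly_ring_over K W)"
  using assms by (auto simp: mem_carrier_poly_ring_over lookup_single when_def)

lemma var_in_poly_ring_over:
  assumes "0 \<in> K" and "1 \<in> K" and "v \<in> W"
  shows "var v \<in> carrier (poly_ring_over K W)"
  unfolding var_def using assms by (intro single_in_poly_ring_over) auto

text \<open>Serves the coefficients of a product, which are nested \<open>Sum_any\<close>
  expressions.\<close>

lemma Sum_any_mem: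
  assumes "0 \<in> K" and "\<And>a b. a \<in> K \<Longrightarrow> b \<in> K \<Longrightarrow> a + b \<in> K" and "\<And>i. f i \<in> K"
  shows "Sum_any f \<in> K"
proof -
  have "sum f A \<in> K" for A
    by (induction A rule: infinite_finite_induct) (auto intro: assms)
  then show ?thesis
    by (simp add: Sum_any.expand_set)
qed

lemma comm_subring_poly_ring_over:
  assumes "subfield K ring_of_type_algebra"
  shows "comm_subring (carrier (poly_ring_over K W))"
proof
  note K = subfield_type_algebraD[OF assms]
  let ?C = "carrier (poly_ring_over K W)"
  fix p q :: "'a rpoly"
  show "1 \<in> ?C"
    unfolding single_one[symmetric] using K by (intro single_in_poly_ring_over) auto
  assume p: "p \<in> ?C"
  show "- p \<in> ?C"
    using p K by (auto simp: mem_carrier_poly_ring_over)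
  assume q: "q \<in> ?C"
  show "p + q \<in> ?C"
    using p q K keys_add[of p q] by (fastforce simp: mem_carrier_poly_ring_over lookup_add)
  show "p * q \<in> ?C"
    unfolding mem_carrier_poly_ring_over
  proof (intro conjI allI ballI)
    fix m
    show "Poly_Mapping.lookup (p * q) m \<in> K"
      unfolding lookup_mult using p q K
      by (intro Sum_any_mem K) (auto simp: mem_carrier_poly_ring_over when_def intro!: Sum_any_mem K)
  next
    fix m assume "m \<in> Poly_Mapping.keys (p * q)"
    then obtain a b where "a \<in> Poly_Mapping.keys p" "b \<in> Poly_Mapping.keys q" "m = a + b"
      using keys_mult[of p q] by auto
    then show "Poly_Mapping.keys m \<subseteq> W"
      using p q keys_add[of a b] unfolding mem_carrier_poly_ring_over by blast
  qed
qed

lemma char0_subring_ideal_poly_ring_over: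
  assumes K: "subfield K ring_of_type_algebra" and "ideal I (poly_ring_over K W)"
  shows "char0_subring_ideal (carrier (poly_ring_over K W)) I"
proof -
  let ?R = "poly_ring_over K W"
  interpret ideal I ?R by fact
  interpret comm_subring "carrier ?R" by (rule comm_subring_poly_ring_over[OF K])
  note K' = subfield_type_algebraD[OF K]
  show ?thesis
  proof
    fix a b :: "'a rpoly" and n :: nat
    show "0 \<in> I"
      using additive_subgroup.zero_closed[OF is_additive_subgroup] by simp
    show "a + b \<in> I" if "a \<in> I" "b \<in> I"
      using additive_subgroup.a_closed[OF is_additive_subgroup that] by simp
    show mult: "a * b \<in> I" if "a \<in> carrier ?R" "b \<in> I" for a b
      using I_l_closed[OF that(2,1)] by simp
    assume n: "of_nat (Suc n) * a \<in> I"
    \<comment> \<open>A subfield contains the naturals and their inverses, so the constant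
      polynomial with coefficient \<open>?c\<close> lies in the ring and multiplying by it divides
      out \<open>Suc n\<close>.\<close>
    have nK: "of_nat n \<in> K" for n
      by (induction n) (auto intro: K')
    let ?c = "inverse (of_nat (Suc n)) :: real"
    have "Poly_Mapping.single 0 ?c * (of_nat (Suc n) * a) \<in> I"
      by (intro mult single_in_poly_ring_over K' nK n) auto
    also have "of_nat (Suc n) = (Poly_Mapping.single 0 (of_nat (Suc n)) :: 'a rpoly)"
      by (metis single_of_nat)
    finally have "(Poly_Mapping.single 0 ?c * Poly_Mapping.single 0 (of_nat (Suc n))) * a \<in> I"
      by (simp only: mult.assoc)
    then show "a \<in> I"
      by (simp add: mult_single del: of_nat_Suc single_of_nat)
  qed
qed

lemma total_degree_le:
  assumes "\<And>m. m \<in> Poly_Mapping.keys p \<Longrightarrow>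
             (\<Sum>v \<in> Poly_Mapping.keys m. Poly_Mapping.lookup m v) \<le> l"
  shows "total_degree p \<le> l"
  using assms by (auto simp: total_degree_def)

lemma total_degree_affine:
  "total_degree ((\<Sum>h \<in> F. var (f h)) - of_nat n) \<le> 1"
proof (rule total_degree_le)
  fix m assume "m \<in> Poly_Mapping.keys ((\<Sum>h \<in> F. var (f h)) - of_nat n)"
  moreover have "Poly_Mapping.keys ((\<Sum>h \<in> F. var (f h)) - of_nat n :: 'a rpoly)
      \<subseteq> (\<Union>h \<in> F. Poly_Mapping.keys (var (f h))) \<union> Poly_Mapping.keys (of_nat n :: 'a rpoly)"
    using keys_diff keys_sum by fast
  moreover have "Poly_Mapping.keys (of_nat n :: 'a rpoly) \<subseteq> {0}"
    by (metis single_of_nat keys_single empty_subsetI subset_refl)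
  ultimately have "m = 0 \<or> (\<exists>h \<in> F. m = Poly_Mapping.single (f h) 1)"
    by (auto simp: var_def)
  then show "(\<Sum>v \<in> Poly_Mapping.keys m. Poly_Mapping.lookup m v) \<le> 1"
    by auto
qed

section \<open>The certificate\<close>

lemma graph_gensI:
  shows "u \<in> V \<Longrightarrow> v \<in> V \<Longrightarrow> u \<noteq> v \<Longrightarrow> (e u v)\<^sup>2 - e u v \<in> graph_gens e V D"
    and "u \<in> V - D \<Longrightarrow> (\<Prod>v \<in> D. 1 - e u v) \<in> graph_gens e V D"
    and "S \<subseteq> V \<Longrightarrow> Suc (card S) = card D \<Longrightarrow>
           (\<Prod>v \<in> V - S. \<Sum>u \<in> S. e u v) \<in> graph_gens e V D"
  unfolding graph_gens_def by blast+

lemma product_gensI: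
  assumes "g \<in> VG" and "h \<in> VH"
  shows "(xp g h)\<^sup>2 - xp g h \<in> product_gens VG VH"
    and "(1 - xp g h) * (\<Prod>g' \<in> VG - {g}. 1 - eG g g' * xp g' h)
                      * (\<Prod>h' \<in> VH - {h}. 1 - eH h h' * xp g h') \<in> product_gens VG VH"
  using assms unfolding product_gens_def by blast+

lemma sum_square_certificate:
  assumes K: "subfield K ring_of_type_algebra"
    and VG: "finite VG" and DG: "DG = VG"
    and VH: "finite VH" and DH: "DH \<subseteq> VH" "Suc (card DH) = card VH"
  shows "sos_certificate (viz_ring K VG VH) (viz_ideal K VG DG VH DH) 1
           VG (\<lambda>g. (\<Sum>h \<in> VH. xp g h) - of_nat (card DH)) (viz_poly VG DG VH DH)"
  unfolding sos_certificate_def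
proof (intro conjI ballI)
  let ?s = "\<lambda>g. (\<Sum>h \<in> VH. xp g h) - of_nat (card DH) :: ('a, 'b) viz_var rpoly"
  let ?R = "viz_ring K VG VH"
  note K' = subfield_type_algebraD[OF K]
  have x_C: "xp g h \<in> carrier ?R" if "g \<in> VG" "h \<in> VH" for g h
    unfolding viz_ring_def xp_def using K' that
    by (intro var_in_poly_ring_over) (auto simp: viz_vars_def)
  have eG_C: "eG u v \<in> carrier ?R" if "u \<in> VG" "v \<in> VG" "u \<noteq> v" for u v
    unfolding viz_ring_def eG_def using K' that
    by (intro var_in_poly_ring_over) (auto simp: viz_vars_def)
  have eH_C: "eH u v \<in> carrier ?R" if "u \<in> VH" "v \<in> VH" "u \<noteq> v" for u v
    unfolding viz_ring_def eH_def using K' that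
    by (intro var_in_poly_ring_over) (auto simp: viz_vars_def)
  show "finite VG" by fact
  show "total_degree (?s g) \<le> 1" for g
    unfolding xp_def by (rule total_degree_affine)
  interpret comm_subring "carrier ?R"
    unfolding viz_ring_def by (rule comm_subring_poly_ring_over[OF K])
  show "?s g \<in> carrier ?R" if "g \<in> VG" for g
    using x_C[OF that] by (intro diff_C sum_C of_nat_C)
  show "viz_poly VG DG VH DH - (\<Sum>g \<in> VG. (?s g)\<^sup>2) \<in> viz_ideal K VG DG VH DH"
    \<comment> \<open>The generated ideal is an intersection, so membership is shown in an arbitrary
      ideal \<open>I\<close> containing the generators.\<close>
    unfolding viz_ideal_def genideal_def
  proof (rule InterI, clarify)
    fix I
    assume I: "ideal I ?R"
      and "graph_gens eG VG DG \<union> graph_gens eH VH DH \<union> product_gens VG VH \<subseteq> I"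
    then have "graph_gens eG VG DG \<subseteq> I" "graph_gens eH VH DH \<subseteq> I" "product_gens VG VH \<subseteq> I"
      by auto
    note gens = this[THEN subsetD]
    from I interpret char0_subring_ideal "carrier ?R" I
      using char0_subring_ideal_poly_ring_over[OF K] unfolding viz_ring_def by blast
    have x_idem: "idem (xp g h)" if "g \<in> VG" "h \<in> VH" for g h
      unfolding idem_def using that by (intro conjI x_C gens(3) product_gensI)
    have eG_idem: "idem (eG u v)" if "u \<in> VG" "v \<in> VG" "u \<noteq> v" for u v
      unfolding idem_def using that by (intro conjI eG_C gens(1) graph_gensI)
    have eH_idem: "idem (eH u v)" if "u \<in> VH" "v \<in> VH" "u \<noteq> v" for u v
      unfolding idem_def using that by (intro conjI eH_C gens(2) graph_gensI)
    have eG_I: "eG u v \<in> I" if "u \<in> VG" "v \<in> VG" "u \<noteq> v" for u v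
    proof (rule edgeless[OF VG eG_idem _ that])
      show "(\<Prod>v \<in> VG - S. \<Sum>u \<in> S. eG u v) \<in> I" if "S \<subseteq> VG" "Suc (card S) = card VG" for S
        using that by (intro gens(1) graph_gensI) (simp_all add: DG)
    qed
    have eH_sym: "eH u v = eH v u" for u v :: 'b
      by (simp add: eH_def insert_commute)
    have eH_orth: "eH a a' * eH b b' \<in> I"
      if "a \<in> VH" "a' \<in> VH" "b \<in> VH" "b' \<in> VH" "a \<noteq> a'" "b \<noteq> b'" "{a, a'} \<noteq> {b, b'}"
      for a a' b b'
    proof (rule distinct_edges_orthogonal[OF VH eH_sym eH_idem _ that])
      show "(\<Prod>v \<in> VH - S. \<Sum>u \<in> S. eH u v) \<in> I"
        if "S \<subseteq> VH" "Suc (Suc (card S)) = card VH" for S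
        using that DH(2) by (intro gens(2) graph_gensI) simp_all
    qed
    have "VH - DH \<noteq> {}"
      using DH by auto
    then obtain d where d: "d \<in> VH - DH" by blast
    then have d_dom: "(\<Prod>v \<in> DH. 1 - eH d v) \<in> I"
      by (intro gens(2) graph_gensI)
    \<comment> \<open>As the edge variables of \<open>G\<close> vanish, the \<open>G\<close>-part of
      the generator is 1 modulo \<open>I\<close>. What remains is domination inside the copy of
      \<open>H\<close> at \<open>g\<close>.\<close>
    have x_dom: "(1 - xp g h) * (\<Prod>k \<in> VH - {h}. 1 - eH h k * xp g k) \<in> I"
      if gh: "g \<in> VG" "h \<in> VH" for g h
    proof (rule cancel_prod_one_minus[where F = "VG - {g}" and f = "\<lambda>g'. eG g g' * xp g' h"])
      let ?Q = "\<Prod>k \<in> VH - {h}. 1 - eH h k * xp g k"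
      let ?f = "\<lambda>g'. eG g g' * xp g' h"
      have Q: "?Q \<in> carrier ?R"
        using gh x_C eH_C by (auto intro!: prod_C diff_C one_C mult_C)
      show "finite (VG - {g})" using VG by simp
      show "?f g' \<in> carrier ?R" if "g' \<in> VG - {g}" for g'
        using that gh x_C eG_C by (auto intro!: mult_C)
      have "?f g' \<in> I" if "g' \<in> VG - {g}" for g'
        using that gh x_C eG_I by (auto intro!: mult_I2)
      then show "(1 - xp g h) * ?Q * ?f g' \<in> I" if "g' \<in> VG - {g}" for g'
        using that Q gh x_C by (intro mult_I[OF mult_C] diff_C one_C) auto
      have "(1 - xp g h) * (\<Prod>g' \<in> VG - {g}. 1 - ?f g') * ?Q \<in> I"
        using gh by (intro gens(3) product_gensI)
      then show "(1 - xp g h) * ?Q * (\<Prod>g' \<in> VG - {g}. 1 - ?f g') \<in> I"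
        by (simp add: mult_ac)
    qed
    \<comment> \<open>\<open>?Y g\<close> counts the vertices of the copy of \<open>H\<close> at
      \<open>g\<close> that are left out of the set.\<close>
    let ?Y = "\<lambda>g. \<Sum>h \<in> VH. 1 - xp g h :: ('a, 'b) viz_var rpoly"
    have Y: "(?Y g)\<^sup>2 - ?Y g \<in> I" if g: "g \<in> VG" for g
    proof (rule orthogonal_idem_sum[OF VH])
      show "idem (1 - xp g h)" if "h \<in> VH" for h
        using x_idem g that by (intro idem_compl)
      show "(1 - xp g h) * (1 - xp g h') \<in> I" if "h \<in> VH" "h' \<in> VH" "h \<noteq> h'" for h h'
        by (rule undominated_orthogonal[OF VH eH_sym eH_idem eH_orth DH(1) d d_dom
              x_idem[OF g] x_dom[OF g] that])
    qed
    have "- (\<Sum>g \<in> VG. (?Y g)\<^sup>2 - ?Y g) \<in> I"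
      by (intro uminus_I sum_I Y)
    also have "- (\<Sum>g \<in> VG. (?Y g)\<^sup>2 - ?Y g) = (\<Sum>g \<in> VG. ?s g - (?s g)\<^sup>2)"
    proof -
      \<comment> \<open>The constants agree because \<open>VH\<close> has one vertex more than
        \<open>DH\<close>. Passing from \<open>Y\<close> to \<open>1 - Y\<close> leaves the
        idempotence defect unchanged.\<close>
      have "?s g = 1 - ?Y g" for g
        by (simp add: sum_subtractf flip: DH(2))
      then show ?thesis
        by (simp only: sum_negf[symmetric])
          (simp add: power2_eq_square left_diff_distrib right_diff_distrib)
    qed
    \<comment> \<open>The constants of the \<open>?s g\<close> add up to
      \<open>card VG * card DH\<close>, which is the constant of the Vizing polynomial since
      \<open>DG = VG\<close>.\<close>
    also have "\<dots> = viz_poly VG DG VH DH - (\<Sum>g \<in> VG. (?s g)\<^sup>2)"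
      by (simp add: sum_subtractf viz_poly_def DG)
    finally show "viz_poly VG DG VH DH - (\<Sum>g \<in> VG. (?s g)\<^sup>2) \<in> I" .
  qed
qed

section \<open>The domination numbers\<close>

lemma dominating_setD:
  assumes "finite (pverts G)" and "dominating_set G D"
  shows "finite D" and "domination_number G \<le> card D"
proof -
  have "finite {D. dominating_set G D}"
    using assms(1) by (rule finite_subset[rotated, OF finite_Pow_iff[THEN iffD2]])
      (auto simp: dominating_set_def)
  then show "domination_number G \<le> card D"
    using assms(2) unfolding domination_number_def by (intro Min_le) auto
  show "finite D"
    using assms finite_subset unfolding dominating_set_def by blast
qed

lemma domination_number_attained:
  assumes "finite (pverts G)"
  obtains D where "dominating_set G D" and "card D = domination_number G"
proof -
  have "finite {D. dominating_set G D}"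
    using assms by (rule finite_subset[rotated, OF finite_Pow_iff[THEN iffD2]])
      (auto simp: dominating_set_def)
  moreover have "dominating_set G (pverts G)"
    by (simp add: dominating_set_def)
  ultimately have "domination_number G \<in> card ` {D. dominating_set G D}"
    unfolding domination_number_def by (intro Min_in) auto
  then show ?thesis
    using that by auto
qed

text \<open>An arc from \<open>u\<close> to \<open>v\<close> would make all vertices except
  \<open>v\<close> a dominating set; \<open>u\<close> remains in it because there are no
  loops.\<close>

lemma no_arcs_if_domination_number_eq_card:
  assumes "pair_digraph G" and "domination_number G = card (pverts G)"
  shows "parcs G = {}"
proof (rule ccontr)
  interpret pair_digraph G by fact
  assume "parcs G \<noteq> {}"
  then obtain u v where uv: "(u, v) \<in> parcs G" by auto
  have mem: "u \<in> pverts G" "v \<in> pverts G" "u \<noteq> v"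
    using arc_fst_in_verts[OF uv] arc_snd_in_verts[OF uv] pair_no_loops[OF uv] by auto
  then have "dominating_set G (pverts G - {v})"
    using uv by (auto simp: dominating_set_def)
  from dominating_setD(2)[OF pair_finite_verts this] show False
    using assms(2) mem pair_finite_verts card_Diff1_less[of "pverts G" v] by simp
qed

text \<open>Without arcs in \<open>G\<close>, the product is a disjoint union of copies of \<open>H\<close>.\<close>

lemma domination_number_cartesian_product_edgeless:
  assumes "finite (pverts G)" and "finite (pverts H)" and "parcs G = {}"
  shows "card (pverts G) * domination_number H \<le> domination_number (cartesian_product G H)"
proof -
  let ?P = "cartesian_product G H"
  have "finite (pverts ?P)"
    using assms by (simp add: cartesian_product_def)
  then obtain D where D: "dominating_set ?P D" "card D = domination_number ?P"
    by (rule domination_number_attained)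
  have "finite D"
    using dominating_setD(1)[OF \<open>finite (pverts ?P)\<close> D(1)] .
  have sub: "D \<subseteq> pverts G \<times> pverts H"
    using D(1) by (simp add: dominating_set_def cartesian_product_def)
  \<comment> \<open>Without arcs in \<open>G\<close>, an arc into \<open>(g, h)\<close> starts in
    the same copy of \<open>H\<close>, so each fibre of \<open>D\<close> dominates its copy.\<close>
  have fib: "dominating_set H (D `` {g})" if g: "g \<in> pverts G" for g
    unfolding dominating_set_def
  proof (intro conjI ballI)
    show "D `` {g} \<subseteq> pverts H" using sub by auto
    fix h assume "h \<in> pverts H - D `` {g}"
    then have "(g, h) \<in> pverts ?P - D"
      using g by (auto simp: cartesian_product_def)
    then obtain p where "p \<in> D" "(p, (g, h)) \<in> parcs ?P"
      using D(1) unfolding dominating_set_def by blast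
    then show "\<exists>k \<in> D `` {g}. (k, h) \<in> parcs H"
      using assms(3) by (auto simp: cartesian_product_def)
  qed
  have "D = (SIGMA g:pverts G. D `` {g})"
    using sub by auto
  then have "card D = (\<Sum>g \<in> pverts G. card (D `` {g}))"
    using assms(1) \<open>finite D\<close> by (metis card_SigmaI finite_Image)
  also have "\<dots> \<ge> (\<Sum>g \<in> pverts G. domination_number H)"
    by (intro sum_mono dominating_setD(2)[OF assms(2) fib])
  finally show ?thesis
    using D(2) by simp
qed

theorem theorem5p12:
  fixes K :: "real set"
    and VG DG :: "'a set" and VH DH :: "'b set"
    and nG kG nH kH :: nat
  assumes "subfield K ring_of_type_algebra"
    and "finite VG" and "card VG = nG" and "DG \<subseteq> VG" and "card DG = kG"
    and "finite VH" and "card VH = nH" and "DH \<subseteq> VH" and "card DH = kH"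
    and "kG = nG" and "nG \<ge> 1"
    and "kH = nH - 1" and "nH - 1 \<ge> 1"
  shows "sos_certificate (viz_ring K VG VH) (viz_ideal K VG DG VH DH) 1
           VG (\<lambda>g. (\<Sum>h \<in> VH. xp g h) - of_nat (nH - 1)) (viz_poly VG DG VH DH)
       \<and> (\<forall>(G :: 'c pair_pre_digraph) (H :: 'd pair_pre_digraph).
            pair_graph G \<longrightarrow> pair_graph H \<longrightarrow>
            card (pverts G) = nG \<longrightarrow> card (pverts H) = nH \<longrightarrow>
            domination_number G = nG \<longrightarrow> domination_number H = nH - 1 \<longrightarrow>
            domination_number G * domination_number H
              \<le> domination_number (cartesian_product G H))"
proof (intro conjI allI impI)
  have "DG = VG"
    using assms by (intro card_subset_eq) auto
  \<comment> \<open>The assumption \<open>nH - 1 >= 1\<close> excludes truncated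
    subtraction.\<close>
  moreover have "Suc (card DH) = card VH" and "nH - 1 = card DH"
    using assms by auto
  ultimately show "sos_certificate (viz_ring K VG VH) (viz_ideal K VG DG VH DH) 1
           VG (\<lambda>g. (\<Sum>h \<in> VH. xp g h) - of_nat (nH - 1)) (viz_poly VG DG VH DH)"
    using sum_square_certificate[of K VG DG VH DH] assms by simp
next
  \<comment> \<open>The inequality is obtained by counting in the graphs themselves:
    \<open>G\<close> has no arcs, and its number of vertices is its domination number.\<close>
  fix G :: "'c pair_pre_digraph" and H :: "'d pair_pre_digraph"
  assume "pair_graph G" and "pair_graph H" and "card (pverts G) = nG" and "domination_number G = nG"
  interpret G: pair_graph G by fact
  interpret H: pair_graph H by fact
  have "parcs G = {}"
    using no_arcs_if_domination_number_eq_card[OF G.pair_digraph]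
      \<open>card (pverts G) = nG\<close> \<open>domination_number G = nG\<close> by simp
  then show "domination_number G * domination_number H
      \<le> domination_number (cartesian_product G H)"
    using domination_number_cartesian_product_edgeless[OF G.pair_finite_verts H.pair_finite_verts]
      \<open>card (pverts G) = nG\<close> \<open>domination_number G = nG\<close> by simp
qed

end
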